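(* Let $t\geq 5$ be an integer, let $d$ be a positive integer, let $(T,B)$ be a canonical territory and let $x,y\in V(B)$ be such that $\mathrm{dist}_T(x,y)\leq d$. Then $\mathrm{dist}_B(x,y)\leq t^{d+3t}$.
   Context: Graphs are finite and simple; $\mathrm{dist}_G(x,y)$ is the length (number of edges) of a shortest path between $x$ and $y$ in $G$. A territory is a pair $(T,B)$ where $T$ is a graph and $B$ is an induced cycle in $T$. Expansion (with respect to the fixed integer $t\geq 5$). Given a territory $(T',B')$, an expansion of it is any territory $(T,B)$ obtained as follows. Choose, for some integer $k\geq 0$, a stable set $\{x_1,\dots,x_k\}$ of vertices of $B'$, and for each $i$ let $x_i^-,x_i^+$ be the two neighbours of $x_i$ in $B'$. Choose $I\subseteq\{1,\dots,k\}$. Build $T$ from $T'$: for each $i$ add a new path $P_i$ of length $2t-6$ with ends $y_i^-,y_i^+$ and middle vertex $y_i$, and add edges $x_i^-y_i^-$, $x_iy_i$, $x_i^+y_i^+$; for each $i\in I$, with $v_i^-,v_i^+$ the neighbours of $y_i$ in $P_i$ ($v_i^-$ on the side of $y_i^-$), add a new path $Q_i$ of length $t-4$ with ends $z_i^-,z_i^+$ and edges $v_i^-z_i^-$, $v_i^+z_i^+$ (all added vertices new and distinct). For $i\notin I$ let $R_i=x_i^-\text{-}y_i^-\text{-}P_i\text{-}y_i^+\text{-}x_i^+$; for $i\in I$ let $R_i$ go $x_i^-,y_i^-$, along $P_i$ to $v_i^-$, then $z_i^-$, along $Q_i$ to $z_i^+$, then $v_i^+$, along $P_i$ to $y_i^+$,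 then $x_i^+$. Let $B=(B'\setminus\{x_1,\dots,x_k\})\cup R_1\cup\dots\cup R_k$. The territories $(T_m,B_m)$, $m\ge0$: $T_0$ is a $t$-cycle and $B_0=T_0$. For $m\geq1$, with $N=t(t-3)^{m-1}$ and $B_{m-1}=x_1\text{-}\cdots\text{-}x_N\text{-}x_1$, obtain $T_m$ from $T_{m-1}$ by adding a new cycle $B_m$ which is the $(t-4)$-subdivision of an $N$-cycle $x_1'\text{-}\cdots\text{-}x_N'\text{-}x_1'$ (each edge replaced by a path of length $t-3$) and adding the edges $x_ix_i'$, $i=1,\dots,N$. A territory $(T,B)$ is canonical if for some $m\geq 0$ there is an expansion $(T',B')$ of $(T_m,B_m)$ and an isomorphism $f:V(T)\to V(T')$ between $T$ and $T'$ whose restriction to $V(B)$ is an isomorphism between $B$ and $B'$. *)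

theory Defs
  imports "HOL-Library.Extended_Nat" "HOL-Library.Disjoint_Sets"
begin

type_synonym 'a graph = "'a set \<times> 'a set set"

abbreviation verts :: "'a graph \<Rightarrow> 'a set" where "verts \<equiv> fst"
abbreviation edges :: "'a graph \<Rightarrow> 'a set set" where "edges \<equiv> snd"

definition simple_graph :: "'a graph \<Rightarrow> bool" where
  "simple_graph G \<longleftrightarrow> finite (verts G) \<and> (\<forall>e\<in>edges G. e \<subseteq> verts G \<and> card e = 2)"

definition graph_un :: "'a graph \<Rightarrow> 'a graph \<Rightarrow> 'a graph" where
  "graph_un G H = (verts G \<union> verts H, edges G \<union> edges H)"

definition graph_UN :: "'i set \<Rightarrow> ('i \<Rightarrow> 'a graph) \<Rightarrow> 'a graph" where
  "graph_UN K G = (\<Union>i\<in>K. verts (G i), \<Union>i\<in>K. edges (G i))"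

definition delete_verts :: "'a graph \<Rightarrow> 'a set \<Rightarrow> 'a graph" where
  "delete_verts G S = (verts G - S, {e \<in> edges G. e \<inter> S = {}})"

definition induced_subgraph :: "'a graph \<Rightarrow> 'a graph \<Rightarrow> bool" where
  "induced_subgraph H G \<longleftrightarrow>
     verts H \<subseteq> verts G \<and> edges H = {e \<in> edges G. e \<subseteq> verts H}"

definition stable_set :: "'a graph \<Rightarrow> 'a set \<Rightarrow> bool" where
  "stable_set G S \<longleftrightarrow> S \<subseteq> verts G \<and> (\<forall>u\<in>S. \<forall>v\<in>S. {u, v} \<notin> edges G)"

definition neighbours :: "'a graph \<Rightarrow> 'a \<Rightarrow> 'a set" where
  "neighbours G v = {u. {v, u} \<in> edges G}"

definition graph_iso :: "('a \<Rightarrow> 'b) \<Rightarrow> 'a graph \<Rightarrow> 'b graph \<Rightarrow> bool" where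
  "graph_iso f G H \<longleftrightarrow> bij_betw f (verts G) (verts H) \<and>
     (\<forall>u\<in>verts G. \<forall>v\<in>verts G. {u, v} \<in> edges G \<longleftrightarrow> {f u, f v} \<in> edges H)"

definition path_edges :: "'a list \<Rightarrow> 'a set set" where
  "path_edges p = {{p ! i, p ! Suc i} | i. Suc i < length p}"

definition path_graph :: "'a list \<Rightarrow> 'a graph" where
  "path_graph p = (set p, path_edges p)"

definition cycle_graph :: "'a list \<Rightarrow> 'a graph" where
  "cycle_graph c = (set c, {{c ! i, c ! (Suc i mod length c)} | i. i < length c})"

definition is_cycle :: "'a graph \<Rightarrow> bool" where
  "is_cycle C \<longleftrightarrow> (\<exists>c. distinct c \<and> 3 \<le> length c \<and> C = cycle_graph c)"

definition path_between :: "'a graph \<Rightarrow> 'a \<Rightarrow> 'a \<Rightarrow> 'a list \<Rightarrow> bool" where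
  "path_between G x y p \<longleftrightarrow> p \<noteq> [] \<and> distinct p \<and> hd p = x \<and> last p = y \<and>
     set p \<subseteq> verts G \<and> path_edges p \<subseteq> edges G"

text \<open>The distance is \<open>\<infinity>\<close> if there is no path.\<close>

definition graph_dist :: "'a graph \<Rightarrow> 'a \<Rightarrow> 'a \<Rightarrow> enat" where
  "graph_dist G x y = (INF p\<in>{p. path_between G x y p}. enat (length p - 1))"

definition territory :: "'a graph \<Rightarrow> 'a graph \<Rightarrow> bool" where
  "territory T B \<longleftrightarrow> simple_graph T \<and> is_cycle B \<and> induced_subgraph B T"

text \<open>
  Paths are given by their vertex lists, so a path of length \<open>l\<close> has \<open>l + 1\<close> entries.
  Below, \<open>xm i\<close> and \<open>xp i\<close> are the two neighbours of \<open>x i\<close> on the cycle. With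
  \<open>P = P\<^sub>i\<close> of length \<open>2t - 6\<close> and \<open>Q = Q\<^sub>i\<close> of length \<open>t - 4\<close>, the named vertices are
  \<open>y\<^sup>- = P ! 0\<close>, \<open>v\<^sup>- = P ! (t - 4)\<close>, \<open>y = P ! (t - 3)\<close>, \<open>v\<^sup>+ = P ! (t - 2)\<close>,
  \<open>y\<^sup>+ = P ! (2t - 6)\<close>, \<open>z\<^sup>- = Q ! 0\<close> and \<open>z\<^sup>+ = Q ! (t - 4)\<close>.
\<close>

definition gadget_P :: "nat \<Rightarrow> 'a \<Rightarrow> 'a \<Rightarrow> 'a \<Rightarrow> 'a list \<Rightarrow> 'a graph" where
  "gadget_P t xm x xp P = (set P, path_edges P \<union>
     {{xm, P ! 0}, {x, P ! (t - 3)}, {xp, P ! (2 * t - 6)}})"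

definition gadget_Q :: "nat \<Rightarrow> 'a list \<Rightarrow> 'a list \<Rightarrow> 'a graph" where
  "gadget_Q t P Q = (set Q, path_edges Q \<union>
     {{P ! (t - 4), Q ! 0}, {P ! (t - 2), Q ! (t - 4)}})"

definition detour_P :: "'a \<Rightarrow> 'a \<Rightarrow> 'a list \<Rightarrow> 'a list" where
  "detour_P xm xp P = [xm] @ P @ [xp]"

definition detour_Q :: "nat \<Rightarrow> 'a \<Rightarrow> 'a \<Rightarrow> 'a list \<Rightarrow> 'a list \<Rightarrow> 'a list" where
  "detour_Q t xm xp P Q = [xm] @ take (t - 3) P @ Q @ drop (t - 2) P @ [xp]"

definition expansion ::
  "nat \<Rightarrow> 'a graph \<Rightarrow> 'a graph \<Rightarrow> 'a graph \<Rightarrow> 'a graph \<Rightarrow> bool" where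
  "expansion t T' B' T B \<longleftrightarrow> territory T' B' \<and> territory T B \<and>
     (\<exists>(k::nat) x xm xp I P Q.
        inj_on x {1..k} \<and> stable_set B' (x ` {1..k}) \<and>
        (\<forall>i\<in>{1..k}. xm i \<noteq> xp i \<and> neighbours B' (x i) = {xm i, xp i}) \<and>
        I \<subseteq> {1..k} \<and>
        (\<forall>i\<in>{1..k}. distinct (P i) \<and> length (P i) = 2 * t - 6 + 1 \<and>
           set (P i) \<inter> verts T' = {}) \<and>
        (\<forall>i\<in>I. distinct (Q i) \<and> length (Q i) = t - 4 + 1 \<and>
           set (Q i) \<inter> verts T' = {}) \<and>
        disjoint_family_on (\<lambda>i. set (P i)) {1..k} \<and>
        disjoint_family_on (\<lambda>i. set (Q i)) I \<and>
        (\<forall>i\<in>{1..k}. \<forall>j\<in>I. set (P i) \<inter> set (Q j) = {}) \<and>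
        T = graph_un T'
              (graph_un (graph_UN {1..k} (\<lambda>i. gadget_P t (xm i) (x i) (xp i) (P i)))
                        (graph_UN I (\<lambda>i. gadget_Q t (P i) (Q i)))) \<and>
        B = graph_un (delete_verts B' (x ` {1..k}))
              (graph_UN {1..k} (\<lambda>i. path_graph
                 (if i \<in> I then detour_Q t (xm i) (xp i) (P i) (Q i)
                  else detour_P (xm i) (xp i) (P i)))))"

text \<open>
  The \<open>i\<close>-th vertex of \<open>B\<^sub>m\<close> is \<open>(m, i)\<close>, for \<open>0 \<le> i < t (t - 3)^m\<close>. In \<open>B\<^sub>m\<^sub>+\<^sub>1\<close>, viewed as
  the \<open>(t - 4)\<close>-subdivision of a cycle on \<open>N = t (t - 3)^m\<close> vertices, the original (non-subdivision)
  vertices are those at the positions \<open>i (t - 3)\<close> with \<open>i < N\<close>.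
\<close>

definition terr_B :: "nat \<Rightarrow> nat \<Rightarrow> (nat \<times> nat) graph" where
  "terr_B t m = cycle_graph (map (Pair m) [0..<t * (t - 3) ^ m])"

primrec terr_T :: "nat \<Rightarrow> nat \<Rightarrow> (nat \<times> nat) graph" where
  "terr_T t 0 = terr_B t 0"
| "terr_T t (Suc m) = graph_un (graph_un (terr_T t m) (terr_B t (Suc m)))
     ({}, {{(m, i), (Suc m, i * (t - 3))} | i. i < t * (t - 3) ^ m})"

text \<open>
  Expansions of \<open>(T\<^sub>m, B\<^sub>m)\<close> are formed inside the infinite type \<open>nat \<times> nat\<close>, which has room for all
  the new vertices; hence every expansion occurs here up to isomorphism.
\<close>

definition canonical_territory :: "nat \<Rightarrow> 'a graph \<Rightarrow> 'a graph \<Rightarrow> bool" where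
  "canonical_territory t T B \<longleftrightarrow> territory T B \<and>
     (\<exists>m T' B' f. expansion t (terr_T t m) (terr_B t m) T' B' \<and>
        graph_iso f T T' \<and> graph_iso f B B')"

end

theory Submission
  imports Defs
begin

text \<open>
  Collapsing every gadget to its vertex \<open>x\<^sub>i\<close> maps each edge of an expansion to an edge or a vertex
  of \<open>T\<^sub>m\<close>, so it suffices to bound distances in \<open>B\<^sub>m\<close> and to lift walks of \<open>B\<^sub>m\<close> back, at the cost
  of traversing one detour (of length below \<open>3t\<close>) per vertex. Put \<open>q = t - 3\<close> and give the vertex
  \<open>(j, i)\<close> of \<open>T\<^sub>m\<close> the angle \<open>i q\<^sup>m\<^sup>-\<^sup>j\<close> modulo \<open>t q\<^sup>m\<close>. Edges between levels preserve the angle,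
  edges of \<open>B\<^sub>j\<close> change it by \<open>q\<^sup>m\<^sup>-\<^sup>j\<close>, and a walk starting on level \<open>m\<close> needs \<open>m - j\<close> steps to
  reach level \<open>j\<close>. Hence \<open>k\<close> steps change the angle by at most
  \<open>1 + q + \<dots> + q\<^sup>k\<^sup>-\<^sup>1 \<le> q\<^sup>k\<close>.
\<close>

section \<open>Walks\<close>

definition adj :: "'a graph \<Rightarrow> ('a \<times> 'a) set" where
  "adj G = {(u, v). {u, v} \<in> edges G}"

text \<open>Walks rather than paths: they may repeat vertices, so they can be concatenated and
  mapped freely. Membership in \<open>verts G\<close> is not demanded, so every \<open>u\<close> is
  joined to itself.\<close>

definition joined :: "'a graph \<Rightarrow> nat \<Rightarrow> 'a \<Rightarrow> 'a \<Rightarrow> bool" where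
  "joined G n u v \<longleftrightarrow> (\<exists>k\<le>n. (u, v) \<in> adj G ^^ k)"

lemma adj_iff: "(u, v) \<in> adj G \<longleftrightarrow> {u, v} \<in> edges G"
  by (simp add: adj_def)

lemma joined_refl: "joined G n u u"
  unfolding joined_def by (rule exI[of _ 0]) simp

lemma joined_edge: "{u, v} \<in> edges G \<Longrightarrow> joined G 1 u v"
  unfolding joined_def by (rule exI[of _ 1]) (simp add: adj_iff)

lemma joined_mono: "joined G n u v \<Longrightarrow> n \<le> n' \<Longrightarrow> joined G n' u v"
  unfolding joined_def using le_trans by blast

lemma joined_trans:
  assumes "joined G n u v" "joined G n' v w"
  shows "joined G (n + n') u w"
proof -
  obtain k k' where "k \<le> n" "k' \<le> n'" "(u, v) \<in> adj G ^^ k" "(v, w) \<in> adj G ^^ k'"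
    using assms unfolding joined_def by blast
  then show ?thesis
    unfolding joined_def by (intro exI[of _ "k + k'"]) (auto simp: relpow_add)
qed

lemma joined_0 [simp]: "joined G 0 u v \<longleftrightarrow> u = v"
  by (simp add: joined_def)

lemma joined_SucE:
  assumes "joined G (Suc n) u w"
  obtains "joined G n u w" | v where "joined G n u v" "{v, w} \<in> edges G"
proof -
  obtain k where k: "k \<le> Suc n" "(u, w) \<in> adj G ^^ k"
    using assms unfolding joined_def by blast
  show ?thesis
  proof (cases k)
    case 0
    then show ?thesis using k that(1) unfolding joined_def by blast
  next
    case (Suc l)
    then obtain v where "(u, v) \<in> adj G ^^ l" "(v, w) \<in> adj G" using k by auto
    moreover have "l \<le> n" using k Suc by simp
    ultimately show ?thesis using that(2) unfolding joined_def adj_iff by blast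
  qed
qed

lemma joined_sym:
  assumes "joined G n u v"
  shows "joined G n v u"
  using assms
proof (induction n arbitrary: v)
  case (Suc n)
  from Suc.prems show ?case
  proof (cases rule: joined_SucE)
    case 1
    then show ?thesis using Suc.IH joined_mono by fastforce
  next
    case (2 w)
    then have "joined G 1 v w" "joined G n w u"
      using Suc.IH joined_edge by (metis insert_commute)+
    then show ?thesis using joined_trans by fastforce
  qed
qed simp

text \<open>An edge that \<open>f\<close> contracts contributes no step, so the image walk can only
  get shorter.\<close>

lemma joined_map:
  assumes "joined G n u v"
    and "\<And>a b. {a, b} \<in> edges G \<Longrightarrow> f a = f b \<or> {f a, f b} \<in> edges H"
  shows "joined H n (f u) (f v)"
  using assms(1)
proof (induction n arbitrary: v)
  case (Suc n)
  from Suc.prems show ?case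
  proof (cases rule: joined_SucE)
    case 1
    then show ?thesis using Suc.IH joined_mono by fastforce
  next
    case (2 w)
    then have "joined H 1 (f w) (f v)"
      using assms(2) joined_edge joined_refl by metis
    then show ?thesis using joined_trans Suc.IH[OF 2(1)] by fastforce
  qed
qed simp

lemma joined_path:
  assumes "path_edges p \<subseteq> edges G" "u \<in> set p" "v \<in> set p"
  shows "joined G (length p - 1) u v"
proof -
  have fwd: "joined G k (p ! i) (p ! (i + k))" if "i + k < length p" for i k
    using that
  proof (induction k)
    case (Suc k)
    have "{p ! (i + k), p ! (Suc (i + k))} \<in> path_edges p"
      unfolding path_edges_def using Suc.prems by auto
    then have "joined G 1 (p ! (i + k)) (p ! (i + Suc k))"
      using assms(1) joined_edge[of "p ! (i + k)" "p ! Suc (i + k)" G] by auto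
    then show ?case using joined_trans Suc by fastforce
  qed simp
  obtain i j where ij: "i < length p" "u = p ! i" "j < length p" "v = p ! j"
    using assms(2,3) by (auto simp: in_set_conv_nth)
  show ?thesis
  proof (cases "i \<le> j")
    case True
    then have "joined G (j - i) u v" using fwd[of i "j - i"] ij by simp
    then show ?thesis by (rule joined_mono) (use ij in linarith)
  next
    case False
    then have "joined G (i - j) u v" using fwd[of j "i - j"] ij joined_sym by simp
    then show ?thesis by (rule joined_mono) (use ij in linarith)
  qed
qed

section \<open>Walks of bounded length versus distance\<close>

lemma joined_if_graph_dist_le:
  assumes "graph_dist G x y \<le> enat d"
  shows "joined G d x y"
proof -
  \<comment> \<open>An infimum lying strictly below a bound has a witness below it; the strict form
    yields an actual path.\<close>
  have "graph_dist G x y < enat (Suc d)"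
    using assms by (simp add: order_le_less_trans)
  then obtain p where p: "path_between G x y p" "length p - 1 \<le> d"
    unfolding graph_dist_def by (auto simp: INF_less_iff)
  have "joined G (length p - 1) x y"
    using p(1) by (intro joined_path) (auto simp: path_between_def)
  then show ?thesis using p(2) by (rule joined_mono)
qed

lemma path_edges_snoc:
  assumes "p \<noteq> []"
  shows "path_edges (p @ [z]) = insert {last p, z} (path_edges p)"
proof -
  obtain n where n: "length p = Suc n" using assms by (cases p) auto
  have "{i. Suc i < length (p @ [z])} = insert n {i. Suc i < length p}"
    using n by auto
  moreover have "path_edges r = (\<lambda>i. {r ! i, r ! Suc i}) ` {i. Suc i < length r}" for r :: "'a list"
    unfolding path_edges_def by auto
  moreover have "last p = p ! n" using assms n by (simp add: last_conv_nth)
  ultimately show ?thesis using n by (auto simp: nth_append)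
qed

lemma path_edges_take: "path_edges (take n p) \<subseteq> path_edges p"
proof
  fix e assume "e \<in> path_edges (take n p)"
  then obtain i where "Suc i < length (take n p)" "e = {take n p ! i, take n p ! Suc i}"
    unfolding path_edges_def by blast
  then show "e \<in> path_edges p" unfolding path_edges_def by auto
qed

text \<open>The path is built step by step along the walk: if the next vertex already lies on the
  path, the path is cut there, otherwise the vertex is appended.\<close>

lemma path_between_if_joined:
  assumes "joined G n x y" "x \<in> verts G" "\<forall>e\<in>edges G. e \<subseteq> verts G"
  shows "\<exists>p. path_between G x y p \<and> length p \<le> Suc n"
  using assms(1)
proof (induction n arbitrary: y)
  case 0
  then have "path_between G x y [x]"
    using assms(2) by (auto simp: path_between_def path_edges_def)
  then show ?case by fastforce
next
  case (Suc n)
  from Suc.prems show ?case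
  proof (cases rule: joined_SucE)
    case 1
    then show ?thesis using Suc.IH le_SucI by blast
  next
    case (2 w)
    obtain p where p: "path_between G x w p" "length p \<le> Suc n"
      using Suc.IH[OF 2(1)] by blast
    show ?thesis
    proof (cases "y \<in> set p")
      case True
      then obtain i where i: "i < length p" "y = p ! i" by (auto simp: in_set_conv_nth)
      \<comment> \<open>\<open>take (Suc i) p\<close> still contains index \<open>i\<close>, so it
        ends in \<open>y\<close>.\<close>
      have "path_between G x y (take (Suc i) p)"
        using p(1) i path_edges_take[of "Suc i" p] set_take_subset[of "Suc i" p]
        unfolding path_between_def by (auto simp: last_conv_nth)
      then show ?thesis using p(2) by (intro exI[of _ "take (Suc i) p"]) auto
    next
      case False
      have "path_between G x y (p @ [y])"
        using p(1) False 2(2) assms(3)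
        by (auto simp: path_between_def path_edges_snoc)
      then show ?thesis using p(2) by (intro exI[of _ "p @ [y]"]) auto
    qed
  qed
qed

lemma graph_dist_le_if_joined:
  assumes "joined G n x y" "x \<in> verts G" "\<forall>e\<in>edges G. e \<subseteq> verts G"
  shows "graph_dist G x y \<le> enat n"
proof -
  obtain p where "path_between G x y p" "length p \<le> Suc n"
    using path_between_if_joined[OF assms] by blast
  then show ?thesis
    unfolding graph_dist_def by (intro INF_lower2[of p]) auto
qed

section \<open>Distances in \<open>B\<^sub>m\<close>\<close>

lemma terr_B_edgeE:
  assumes "e \<in> edges (terr_B t m)"
  obtains i where "i < t * (t - 3) ^ m" "e = {(m, i), (m, Suc i mod (t * (t - 3) ^ m))}"
proof -
  define N where "N = t * (t - 3) ^ m"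
  obtain i where i: "i < N"
    "e = {map (Pair m) [0..<N] ! i, map (Pair m) [0..<N] ! (Suc i mod N)}"
    using assms unfolding terr_B_def cycle_graph_def N_def[symmetric] by auto
  moreover have "Suc i mod N < N" using i(1) by (intro mod_less_divisor) linarith
  ultimately show thesis using that[of i] unfolding N_def[symmetric] by simp
qed

lemma terr_B_edgeI:
  assumes "i < t * (t - 3) ^ m"
  shows "{(m, i), (m, Suc i mod (t * (t - 3) ^ m))} \<in> edges (terr_B t m)"
proof -
  define N where "N = t * (t - 3) ^ m"
  have "i < N" using assms by (simp add: N_def)
  moreover from this have "Suc i mod N < N" by (intro mod_less_divisor) linarith
  ultimately have "{(m, i), (m, Suc i mod N)} = {map (Pair m) [0..<N] ! i,
      map (Pair m) [0..<N] ! (Suc i mod length (map (Pair m) [0..<N]))}"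
    by simp
  then show ?thesis
    unfolding terr_B_def cycle_graph_def N_def[symmetric] snd_conv
    by (intro CollectI exI[of _ i] conjI) (simp_all add: \<open>i < N\<close>)
qed

lemma verts_terr_B: "verts (terr_B t m) = Pair m ` {..<t * (t - 3) ^ m}"
  unfolding terr_B_def cycle_graph_def by (simp add: atLeast0LessThan)

lemma terr_T_edgeE:
  assumes "e \<in> edges (terr_T t m)"
  obtains j where "j \<le> m" "e \<in> edges (terr_B t j)"
  | j i where "j < m" "e = {(j, i), (Suc j, i * (t - 3))}"
  using assms
proof (induction m arbitrary: thesis)
  case (Suc m)
  from Suc.prems(3) consider "e \<in> edges (terr_T t m)" | "e \<in> edges (terr_B t (Suc m))"
    | i where "e = {(m, i), (Suc m, i * (t - 3))}"
    by (auto simp: graph_un_def)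
  then show ?case
  proof cases
    case 1
    show ?thesis
      by (rule Suc.IH[OF _ _ 1]) (use Suc.prems(1,2) in \<open>auto intro: le_SucI less_SucI\<close>)
  qed (use Suc.prems(1,2) in auto)
qed auto

section \<open>Change of angle along a walk in \<open>terr_T\<close>\<close>

definition angle :: "nat \<Rightarrow> nat \<Rightarrow> nat \<times> nat \<Rightarrow> int" where
  "angle q m v = int (snd v) * int q ^ (m - fst v)"

text \<open>Angles are unreduced integers compared by divisibility, with a signed change
  \<open>s\<close>, so that changes add up along a walk. The bound
  \<open>fst u \<le> Suc (fst v)\<close> records that a step goes down at most one level.\<close>

lemma angle_step:
  assumes "{u, v} \<in> edges (terr_T t m)"
  shows "fst v \<le> m \<and> fst u \<le> Suc (fst v) \<and>
    (\<exists>s. \<bar>s\<bar> \<le> int (t - 3) ^ (m - fst u) \<and>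
      int (t * (t - 3) ^ m) dvd angle (t - 3) m v - angle (t - 3) m u - s)"
  using assms
proof (cases rule: terr_T_edgeE)
  case (1 j)
  define q where "q = t - 3"
  define N where "N = t * q ^ j"
  obtain i where e: "{u, v} = {(j, i), (j, Suc i mod N)}"
    using 1 unfolding N_def q_def by (metis terr_B_edgeE)
  have M: "int (t * q ^ m) = int N * int q ^ (m - j)"
    using \<open>j \<le> m\<close> by (simp add: N_def mult.assoc flip: power_add)
  \<comment> \<open>Reducing \<open>Suc i\<close> modulo \<open>N\<close> changes it by a multiple
    of \<open>N\<close>, which scales to a multiple of the full turn \<open>t * q ^ m\<close>; this
    covers the edge that closes the cycle.\<close>
  have "int N dvd int (Suc i mod N) - int (Suc i)"
    by (metis mod_eq_dvd_iff mod_mod_trivial zmod_int)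
  then have "int (t * q ^ m) dvd (int (Suc i mod N) - int (Suc i)) * int q ^ (m - j)"
    unfolding M by (rule mult_dvd_mono) simp
  also have "(int (Suc i mod N) - int (Suc i)) * int q ^ (m - j)
      = angle q m (j, Suc i mod N) - angle q m (j, i) - int q ^ (m - j)"
    by (simp add: angle_def algebra_simps)
  finally have d: "int (t * q ^ m) dvd
      angle q m (j, Suc i mod N) - angle q m (j, i) - int q ^ (m - j)" .
  \<comment> \<open>Traversing the same edge backwards negates the change.\<close>
  then have d': "int (t * q ^ m) dvd
      angle q m (j, i) - angle q m (j, Suc i mod N) - (- (int q ^ (m - j)))"
    by (subst dvd_minus_iff[symmetric]) (simp add: algebra_simps)
  have b: "\<bar>int q ^ (m - j)\<bar> \<le> int q ^ (m - j)" "\<bar>- (int q ^ (m - j))\<bar> \<le> int q ^ (m - j)"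
    by simp_all
  from e consider "u = (j, i)" "v = (j, Suc i mod N)" | "v = (j, i)" "u = (j, Suc i mod N)"
    by (auto simp: doubleton_eq_iff)
  then show ?thesis
    unfolding q_def[symmetric] using d d' b \<open>j \<le> m\<close> by cases (metis fst_conv le_SucI order_refl)+
next
  case (2 j i)
  \<comment> \<open>From level \<open>j\<close> to \<open>Suc j\<close> the exponent drops by one
    and the index gains the factor \<open>t - 3\<close> in exchange; hence
    \<open>s = 0\<close>.\<close>
  have "m - j = Suc (m - Suc j)" using \<open>j < m\<close> by simp
  then have "angle (t - 3) m (j, i) = angle (t - 3) m (Suc j, i * (t - 3))"
    by (simp add: angle_def)
  moreover have "u = (j, i) \<and> v = (Suc j, i * (t - 3)) \<or> v = (j, i) \<and> u = (Suc j, i * (t - 3))"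
    using 2 by (auto simp: doubleton_eq_iff)
  ultimately show ?thesis using \<open>j < m\<close> by (auto intro!: exI[of _ 0])
qed

text \<open>The level bound \<open>m \<le> fst v + n\<close> belongs to the induction because it
  limits the next step: at level at least \<open>m - n\<close> an edge turns by at most
  \<open>(t - 3) ^ n\<close>.\<close>

lemma angle_joined:
  assumes "5 \<le> t" "joined (terr_T t m) n (m, a) v"
  shows "fst v \<le> m \<and> m \<le> fst v + n \<and>
    (\<exists>s. \<bar>s\<bar> \<le> int (t - 3) ^ n \<and>
      int (t * (t - 3) ^ m) dvd angle (t - 3) m v - angle (t - 3) m (m, a) - s)"
  using assms(2)
proof (induction n arbitrary: v)
  case 0
  then show ?case by (auto intro!: exI[of _ 0])
next
  case (Suc n)
  define q where "q = t - 3"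
  have q: "2 \<le> int q" using assms(1) unfolding q_def by linarith
  \<comment> \<open>As \<open>q \<ge> 2\<close>, the \<open>q ^ n\<close> for the first
    \<open>n\<close> steps and the \<open>q ^ n\<close> for the next one together stay below
    \<open>q ^ Suc n\<close>; this stands in for summing the geometric series.\<close>
  have double: "2 * int q ^ n \<le> int q ^ Suc n"
    using q by (simp add: mult_right_mono)
  from Suc.prems show ?case
  proof (cases rule: joined_SucE)
    case 1
    have "int q ^ n \<le> int q ^ Suc n" using q by (intro power_increasing) auto
    then show ?thesis using Suc.IH[OF 1] unfolding q_def by force
  next
    case (2 w)
    obtain s where s: "\<bar>s\<bar> \<le> int q ^ n"
        "int (t * q ^ m) dvd angle q m w - angle q m (m, a) - s"
      and w: "fst w \<le> m" "m \<le> fst w + n"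
      using Suc.IH[OF 2(1)] unfolding q_def by blast
    obtain r where r: "\<bar>r\<bar> \<le> int q ^ (m - fst w)"
        "int (t * q ^ m) dvd angle q m v - angle q m w - r"
      and v: "fst v \<le> m" "fst w \<le> Suc (fst v)"
      using angle_step[OF 2(2)] unfolding q_def by blast
    have "int q ^ (m - fst w) \<le> int q ^ n"
      using q w by (intro power_increasing) auto
    then have "\<bar>s + r\<bar> \<le> int q ^ Suc n" using s r double by linarith
    moreover have "angle q m v - angle q m (m, a) - (s + r)
        = (angle q m w - angle q m (m, a) - s) + (angle q m v - angle q m w - r)"
      by simp
    then have "int (t * q ^ m) dvd angle q m v - angle q m (m, a) - (s + r)"
      using dvd_add[OF s(2) r(2)] by metis
    ultimately show ?thesis using v w unfolding q_def by auto
  qed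
qed

section \<open>Turning angles back into walks in \<open>terr_B\<close>\<close>

lemma joined_terr_B_shift:
  assumes "a < t * (t - 3) ^ m"
  shows "joined (terr_B t m) n (m, a) (m, (a + n) mod (t * (t - 3) ^ m))"
proof (induction n)
  case 0
  then show ?case using assms by simp
next
  case (Suc n)
  let ?N = "t * (t - 3) ^ m"
  have "(a + n) mod ?N < ?N" using assms by (intro mod_less_divisor) linarith
  from terr_B_edgeI[OF this]
  have "joined (terr_B t m) 1 (m, (a + n) mod ?N) (m, (a + Suc n) mod ?N)"
    using joined_edge by (metis add_Suc_right mod_Suc_eq)
  from joined_trans[OF Suc.IH this] show ?case by simp
qed

text \<open>A change \<open>s\<close> of position is realised by \<open>\<bar>s\<bar>\<close> steps
  round the cycle, in the direction given by the sign; the walk may wind round several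
  times.\<close>

lemma joined_terr_B_if_cong:
  assumes "a < t * (t - 3) ^ m" "b < t * (t - 3) ^ m"
    and "int (t * (t - 3) ^ m) dvd int b - int a - s"
  shows "joined (terr_B t m) (nat \<bar>s\<bar>) (m, a) (m, b)"
proof -
  let ?N = "t * (t - 3) ^ m"
  have shift: "joined (terr_B t m) (nat r) (m, c) (m, d)"
    if "c < ?N" "d < ?N" "int ?N dvd int d - int c - r" "0 \<le> r" for c d r
  proof -
    have "int d mod int ?N = (int c + r) mod int ?N"
      using that(3) by (simp add: mod_eq_dvd_iff algebra_simps)
    also have "int c + r = int (c + nat r)" using that(4) by simp
    finally have "d mod ?N = (c + nat r) mod ?N" by (metis of_nat_eq_iff zmod_int)
    then show ?thesis using joined_terr_B_shift[OF that(1), of "nat r"] that(2) by simp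
  qed
  show ?thesis
  proof (cases "0 \<le> s")
    case True
    then show ?thesis using shift[of a b s] assms by simp
  next
    case False
    have "int ?N dvd int a - int b - (- s)"
      using assms(3) by (subst dvd_minus_iff[symmetric]) (simp add: algebra_simps)
    then show ?thesis using shift[of b a "- s"] assms False joined_sym by simp
  qed
qed

text \<open>On level \<open>m\<close> the exponent \<open>m - fst v\<close> vanishes, so the angle
  of a vertex is its position on the cycle and the bound on the turn is a bound on steps along the
  cycle.\<close>

lemma joined_terr_B_if_joined_terr_T:
  assumes "5 \<le> t" "u \<in> verts (terr_B t m)" "v \<in> verts (terr_B t m)"
    and "joined (terr_T t m) n u v"
  shows "joined (terr_B t m) ((t - 3) ^ n) u v"
proof -
  obtain a b where ab: "u = (m, a)" "a < t * (t - 3) ^ m" "v = (m, b)" "b < t * (t - 3) ^ m"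
    using assms(2,3) by (auto simp: verts_terr_B)
  obtain s where s: "\<bar>s\<bar> \<le> int (t - 3) ^ n"
      "int (t * (t - 3) ^ m) dvd angle (t - 3) m v - angle (t - 3) m u - s"
    using angle_joined[OF assms(1), of m n a v] assms(4) ab(1) by blast
  have "joined (terr_B t m) (nat \<bar>s\<bar>) u v"
    using joined_terr_B_if_cong ab s(2) by (simp add: angle_def)
  moreover have "nat \<bar>s\<bar> \<le> (t - 3) ^ n"
    using s(1) by (metis nat_le_iff of_nat_power)
  ultimately show ?thesis by (rule joined_mono)
qed

section \<open>Collapsing the gadgets of an expansion\<close>

text \<open>Counterpart of \<open>joined_map\<close> that pulls a walk back. Each of the at most
  \<open>n\<close> edges lifts to one edge of \<open>G\<close>, and in each of the at most
  \<open>n + 1\<close> fibres visited \<open>c\<close> steps suffice to get from the vertex of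
  arrival to that of departure.\<close>

lemma joined_lift:
  assumes "joined H n (\<phi> u) (\<phi> v)" "u \<in> verts G" "v \<in> verts G"
    and fibre: "\<And>u v. u \<in> verts G \<Longrightarrow> v \<in> verts G \<Longrightarrow> \<phi> u = \<phi> v \<Longrightarrow> joined G c u v"
    and edge: "\<And>a b. {a, b} \<in> edges H \<Longrightarrow>
      \<exists>u\<in>verts G. \<exists>v\<in>verts G. \<phi> u = a \<and> \<phi> v = b \<and> {u, v} \<in> edges G"
  shows "joined G (n + Suc n * c) u v"
  using assms(1,3)
proof (induction n arbitrary: v)
  case 0
  then show ?case using fibre assms(2) by simp
next
  case (Suc n)
  from Suc.prems(1) show ?case
  proof (cases rule: joined_SucE)
    case 1
    then show ?thesis by (intro joined_mono[OF Suc.IH[OF 1 Suc.prems(2)]]) simp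
  next
    case (2 b)
    obtain w w' where w: "w \<in> verts G" "w' \<in> verts G" "\<phi> w = b" "\<phi> w' = \<phi> v" "{w, w'} \<in> edges G"
      using edge[OF 2(2)] by blast
    have "joined G (n + Suc n * c) u w" using Suc.IH w 2(1) by simp
    moreover have "joined G 1 w w'" using joined_edge[OF w(5)] .
    moreover have "joined G c w' v" using fibre w Suc.prems by blast
    ultimately have "joined G (n + Suc n * c + 1 + c) u v" by (metis joined_trans)
    then show ?thesis by (simp add: algebra_simps)
  qed
qed

lemma territory_edges_subset:
  assumes "territory T B"
  shows "\<forall>e\<in>edges T. e \<subseteq> verts T" "\<forall>e\<in>edges B. e \<subseteq> verts B"
    "edges B \<subseteq> edges T" "verts B \<subseteq> verts T"
  using assms unfolding territory_def simple_graph_def induced_subgraph_def by auto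

lemma path_edges_subset: "e \<in> path_edges p \<Longrightarrow> e \<subseteq> set p"
  unfolding path_edges_def by auto

text \<open>The first property feeds \<open>joined_map\<close> from \<open>T\<close> to
  \<open>T'\<close>, the second puts the ends of the image walk on \<open>B'\<close>, and the last
  two are the fibre and edge hypotheses of \<open>joined_lift\<close>, which returns from
  \<open>B'\<close> to \<open>B\<close>.\<close>

lemma expansion_collapse:
  assumes "5 \<le> t" "expansion t T' B' T B"
  obtains \<phi> where
    "\<And>u v. {u, v} \<in> edges T \<Longrightarrow> \<phi> u = \<phi> v \<or> {\<phi> u, \<phi> v} \<in> edges T'"
    "\<And>u. u \<in> verts B \<Longrightarrow> \<phi> u \<in> verts B'"
    "\<And>u v. u \<in> verts B \<Longrightarrow> v \<in> verts B \<Longrightarrow> \<phi> u = \<phi> v \<Longrightarrow> joined B (3 * t) u v"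
    "\<And>a b. {a, b} \<in> edges B' \<Longrightarrow>
      \<exists>u\<in>verts B. \<exists>v\<in>verts B. \<phi> u = a \<and> \<phi> v = b \<and> {u, v} \<in> edges B"
proof -
  obtain k x xm xp I P Q where terr: "territory T' B'" "territory T B"
    and inj: "inj_on x {1..k::nat}" and stable: "stable_set B' (x ` {1..k})"
    and nb: "\<forall>i\<in>{1..k}. xm i \<noteq> xp i \<and> neighbours B' (x i) = {xm i, xp i}"
    and I: "I \<subseteq> {1..k}"
    and P: "\<forall>i\<in>{1..k}. distinct (P i) \<and> length (P i) = 2 * t - 6 + 1 \<and> set (P i) \<inter> verts T' = {}"
    and Q: "\<forall>i\<in>I. distinct (Q i) \<and> length (Q i) = t - 4 + 1 \<and> set (Q i) \<inter> verts T' = {}"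
    and disjP: "disjoint_family_on (\<lambda>i. set (P i)) {1..k}"
    and disjQ: "disjoint_family_on (\<lambda>i. set (Q i)) I"
    and disjPQ: "\<forall>i\<in>{1..k}. \<forall>j\<in>I. set (P i) \<inter> set (Q j) = {}"
    and T: "T = graph_un T'
              (graph_un (graph_UN {1..k} (\<lambda>i. gadget_P t (xm i) (x i) (xp i) (P i)))
                        (graph_UN I (\<lambda>i. gadget_Q t (P i) (Q i))))"
    and B: "B = graph_un (delete_verts B' (x ` {1..k}))
              (graph_UN {1..k} (\<lambda>i. path_graph
                 (if i \<in> I then detour_Q t (xm i) (xp i) (P i) (Q i)
                  else detour_P (xm i) (xp i) (P i))))"
    using assms(2) unfolding expansion_def by (elim conjE exE) blast
  define K where "K = {1..k}"
  define X where "X = x ` K"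
  define R where "R i = (if i \<in> I then detour_Q t (xm i) (xp i) (P i) (Q i)
                  else detour_P (xm i) (xp i) (P i))" for i
  note inj = inj[folded K_def] and stable = stable[folded K_def] and nb = nb[folded K_def]
    and P = P[folded K_def] and disjP = disjP[folded K_def] and disjPQ = disjPQ[folded K_def]
    and T = T[folded K_def] and B = B[folded K_def] and IK = I[folded K_def]
  note T'sub = territory_edges_subset[OF terr(1)]
  note Bsub = territory_edges_subset[OF terr(2)]
  \<comment> \<open>The new vertices of the \<open>i\<close>-th gadget. These sets avoid
    \<open>T'\<close> and each other, so the index in the definition of \<open>\<phi>\<close> is
    unique.\<close>
  define W where "W i = set (P i) \<union> (if i \<in> I then set (Q i) else {})" for i
  have W_T': "W i \<inter> verts T' = {}" if "i \<in> K" for i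
    using P Q that unfolding W_def by auto
  have W_inj: "i = j" if "u \<in> W i" "u \<in> W j" "i \<in> K" "j \<in> K" for i j u
    using that disjP disjQ disjPQ IK unfolding W_def disjoint_family_on_def
    by (auto split: if_splits) blast+
  define \<phi> where "\<phi> u = (if u \<in> verts T' then u else x (THE i. i \<in> K \<and> u \<in> W i))" for u
  have \<phi>_id: "\<phi> u = u" if "u \<in> verts T'" for u using that by (simp add: \<phi>_def)
  have \<phi>_W: "\<phi> u = x i" if "i \<in> K" "u \<in> W i" for u i
  proof -
    have "(THE j. j \<in> K \<and> u \<in> W j) = i" using that W_inj by (intro the_equality) auto
    then show ?thesis using that W_T' unfolding \<phi>_def by auto
  qed
  have PW: "set (P i) \<subseteq> W i" for i by (simp add: W_def)
  have QW: "set (Q i) \<subseteq> W i" if "i \<in> I" for i using that by (simp add: W_def)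
  have lenP: "length (P i) = 2 * t - 5" if "i \<in> K" for i using P that assms(1) by auto
  have lenQ: "length (Q i) = t - 3" if "i \<in> I" for i using Q that assms(1) by auto
  have P_in: "P i ! n \<in> W i" if "i \<in> K" "n \<le> 2 * t - 6" for i n
  proof -
    have "n < length (P i)" using lenP[OF that(1)] that(2) assms(1) by linarith
    then show ?thesis using PW nth_mem by blast
  qed
  have Q_in: "Q i ! n \<in> W i" if "i \<in> I" "n \<le> t - 4" for i n
  proof -
    have "n < length (Q i)" using lenQ[OF that(1)] that(2) assms(1) by linarith
    then show ?thesis using QW[OF that(1)] nth_mem by blast
  qed
  have nbe: "{x i, xm i} \<in> edges B'" "{x i, xp i} \<in> edges B'" if "i \<in> K" for i
    using nb that unfolding neighbours_def by auto
  \<comment> \<open>Stability of \<open>X\<close> keeps the neighbours of each \<open>x i\<close>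
    out of \<open>X\<close>, so they survive in \<open>B\<close>.\<close>
  have nbX: "xm i \<in> verts B' - X" "xp i \<in> verts B' - X" "x i \<in> verts B'" if "i \<in> K" for i
    using nbe[OF that] T'sub(2) stable that unfolding stable_set_def X_def by auto
  have \<phi>_B': "\<phi> u = u" if "u \<in> verts B'" for u using that T'sub(4) \<phi>_id by blast

  \<comment> \<open>Quantifying over all pairs in \<open>e\<close> covers both orientations. Edges
    within a gadget and the edge from \<open>x i\<close> to the middle of \<open>P i\<close>
    collapse; the edges from \<open>xm i\<close> and \<open>xp i\<close> to the ends of
    \<open>P i\<close> become edges of \<open>B'\<close> at \<open>x i\<close>.\<close>
  have edge_T: "\<forall>u\<in>e. \<forall>v\<in>e. \<phi> u = \<phi> v \<or> {\<phi> u, \<phi> v} \<in> edges T'" if "e \<in> edges T" for e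
  proof -
    have "e \<subseteq> W i" if "e \<in> path_edges (P i)" for i
      using that PW path_edges_subset by (metis order_trans)
    moreover have "e \<subseteq> W i" if "i \<in> I" "e \<in> path_edges (Q i)" for i
      using that QW path_edges_subset by (metis order_trans)
    ultimately consider "e \<in> edges T'"
      | i where "i \<in> K" "e \<subseteq> W i"
      | i where "i \<in> K" "e = {xm i, P i ! 0}"
      | i where "i \<in> K" "e = {x i, P i ! (t - 3)}"
      | i where "i \<in> K" "e = {xp i, P i ! (2 * t - 6)}"
      | i where "i \<in> I" "e = {P i ! (t - 4), Q i ! 0}"
      | i where "i \<in> I" "e = {P i ! (t - 2), Q i ! (t - 4)}"
      using \<open>e \<in> edges T\<close> IK unfolding T graph_un_def graph_UN_def gadget_P_def gadget_Q_def
      by auto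
    then show ?thesis
    proof cases
      case 1
      then have "card e = 2" "e \<subseteq> verts T'"
        using terr(1) unfolding territory_def simple_graph_def by auto
      then obtain a b where ab: "e = {a, b}" "a \<in> verts T'" "b \<in> verts T'"
        unfolding card_2_iff by blast
      then have "\<phi> a = a" "\<phi> b = b" using \<phi>_id by blast+
      then show ?thesis using 1 ab(1) by (metis empty_iff insert_commute insert_iff)
    next
      case (2 i)
      then show ?thesis using \<phi>_W by (metis subsetD)
    next
      case (3 i)
      then have "\<phi> (xm i) = xm i" "\<phi> (P i ! 0) = x i"
        using \<phi>_B' nbX \<phi>_W P_in by auto
      then show ?thesis using 3 nbe T'sub(3) by (auto simp: insert_commute)
    next
      case (4 i)
      then have "\<phi> (x i) = x i" "\<phi> (P i ! (t - 3)) = x i"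
        using \<phi>_B' nbX \<phi>_W P_in[of i "t - 3"] by auto
      then show ?thesis using 4 by auto
    next
      case (5 i)
      then have "\<phi> (xp i) = xp i" "\<phi> (P i ! (2 * t - 6)) = x i"
        using \<phi>_B' nbX \<phi>_W P_in by auto
      then show ?thesis using 5 nbe T'sub(3) by (auto simp: insert_commute)
    next
      case (6 i)
      then have "e \<subseteq> W i" "i \<in> K" using P_in[of i "t - 4"] Q_in IK by auto
      then show ?thesis using \<phi>_W by (metis subsetD)
    next
      case (7 i)
      then have "e \<subseteq> W i" "i \<in> K" using P_in[of i "t - 2"] Q_in IK assms(1) by auto
      then show ?thesis using \<phi>_W by (metis subsetD)
    qed
  qed

  have R_set: "set (R i) \<subseteq> {xm i, xp i} \<union> W i" for i
    unfolding R_def detour_P_def detour_Q_def W_def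
    using set_take_subset[of _ "P i"] set_drop_subset[of _ "P i"] by auto
  \<comment> \<open>A detour has \<open>2 * t - 3\<close> vertices without \<open>Q i\<close>, and
    \<open>3 * t - 7\<close> with it: the middle vertex of \<open>P i\<close> is replaced by the
    \<open>t - 3\<close> vertices of \<open>Q i\<close>.\<close>
  have R_len: "length (R i) \<le> 3 * t" if "i \<in> K" for i
    using lenP[OF that] lenQ[of i] assms(1) unfolding R_def detour_P_def detour_Q_def by auto
  have verts_B: "verts B = (verts B' - X) \<union> (\<Union>i\<in>K. set (R i))"
    and edges_B: "edges B = {e \<in> edges B'. e \<inter> X = {}} \<union> (\<Union>i\<in>K. path_edges (R i))"
    unfolding B R_def X_def graph_un_def delete_verts_def graph_UN_def path_graph_def by simp_all
  have verts_B_cases: "u \<in> verts B' - X \<or> (\<exists>i\<in>K. u \<in> W i \<and> u \<in> set (R i))" if "u \<in> verts B" for u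
    using that R_set nbX unfolding verts_B by blast

  have image_B: "\<phi> u \<in> verts B'" if "u \<in> verts B" for u
    using verts_B_cases[OF that] \<phi>_B' \<phi>_W nbX by (metis DiffD1)

  have fibre: "joined B (3 * t) u v" if uv: "u \<in> verts B" "v \<in> verts B" "\<phi> u = \<phi> v" for u v
  \<comment> \<open>Within \<open>B\<close>, the fibre over \<open>x i\<close> lies on the single
    path \<open>R i\<close>, since \<open>x i\<close> itself was deleted and \<open>x\<close> is
    injective; every other fibre is a single vertex.\<close>
  proof (cases "\<phi> u \<in> X")
    case True
    then obtain i where i: "i \<in> K" "\<phi> u = x i" unfolding X_def by blast
    have "w \<in> set (R i)" if w: "w \<in> verts B" "\<phi> w = x i" for w
    proof -
      have "w \<notin> verts B' - X" using w \<phi>_B' i unfolding X_def by auto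
      then obtain j where j: "j \<in> K" "w \<in> W j" "w \<in> set (R j)" using verts_B_cases w by blast
      then have "x j = x i" using \<phi>_W w by metis
      then show ?thesis using inj i j unfolding inj_on_def by auto
    qed
    then have "u \<in> set (R i)" "v \<in> set (R i)" using uv i by auto
    moreover have "path_edges (R i) \<subseteq> edges B" using i unfolding edges_B by auto
    ultimately have "joined B (length (R i) - 1) u v" by (intro joined_path)
    then show ?thesis by (rule joined_mono) (use R_len[OF i(1)] in linarith)
  next
    case False
    have "w = \<phi> w" if "w \<in> verts B" "\<phi> w \<notin> X" for w
    proof -
      have "w \<notin> W i" if "i \<in> K" for i using \<phi>_W \<open>\<phi> w \<notin> X\<close> that unfolding X_def by blast
      then have "w \<in> verts B'" using verts_B_cases[OF \<open>w \<in> verts B\<close>] by blast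
      then show ?thesis by (rule \<phi>_B'[symmetric])
    qed
    then have "u = v" using uv False by metis
    then show ?thesis using joined_refl by simp
  qed

  \<comment> \<open>An edge of \<open>B'\<close> at \<open>x i\<close> lifts to the first or the
    last edge of \<open>R i\<close>, whose inner end is an end of \<open>P i\<close> and so maps to
    \<open>x i\<close>.\<close>
  have ends: "\<exists>v\<in>verts B. \<phi> v = x i \<and> {b, v} \<in> edges B"
    if i: "i \<in> K" and b: "b = xm i \<or> b = xp i" for i b
  proof -
    have Pne: "P i \<noteq> []" using lenP[OF i] assms(1) by auto
    have mem: "P i ! 0 \<in> W i" "P i ! (2 * t - 6) \<in> W i" using P_in i by auto
    have len: "2 \<le> length (R i)" and R0: "R i ! 0 = xm i"
      unfolding R_def detour_P_def detour_Q_def by auto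
    have R1: "R i ! 1 = P i ! 0"
      using lenP[OF i] assms(1) unfolding R_def detour_P_def detour_Q_def
      by (auto simp: nth_append)
    \<comment> \<open>Both kinds of detour end with a non-empty tail of \<open>P i\<close> followed
      by \<open>xp i\<close>, so the last edge can be found uniformly.\<close>
    have "last (P i) = P i ! (2 * t - 6)"
      using Pne lenP[OF i] by (simp add: last_conv_nth)
    moreover have "drop (t - 2) (P i) \<noteq> []" "t - 2 < length (P i)"
      using lenP[OF i] assms(1) by auto
    ultimately have Rl: "R i = butlast (R i) @ [xp i]" "last (butlast (R i)) = P i ! (2 * t - 6)"
      using Pne unfolding R_def detour_P_def detour_Q_def by (auto simp: butlast_append)
    have "{xm i, P i ! 0} \<in> path_edges (R i)"
      using len R0 R1 unfolding path_edges_def by force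
    moreover have "butlast (R i) \<noteq> []" using len by (cases "R i") auto
    then have "{P i ! (2 * t - 6), xp i} \<in> path_edges (R i)"
      using path_edges_snoc[of "butlast (R i)" "xp i"] Rl by simp
    ultimately have "{xm i, P i ! 0} \<in> edges B" "{xp i, P i ! (2 * t - 6)} \<in> edges B"
      using i unfolding edges_B by (auto simp: insert_commute)
    then show ?thesis using b Bsub(2) \<phi>_W[OF i] mem by blast
  qed
  have endX: "\<exists>v\<in>verts B. \<phi> v = a \<and> {b, v} \<in> edges B \<and> b \<in> verts B \<and> \<phi> b = b"
    if ab: "{a, b} \<in> edges B'" "a \<in> X" for a b
  proof -
    obtain i where i: "i \<in> K" "a = x i" using ab(2) unfolding X_def by blast
    then have "b = xm i \<or> b = xp i" using nb ab(1) unfolding neighbours_def by auto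
    moreover from this have "b \<in> verts B" "\<phi> b = b" using nbX i \<phi>_B' unfolding verts_B by auto
    ultimately show ?thesis using ends i by blast
  qed
  have edge_B: "\<exists>u\<in>verts B. \<exists>v\<in>verts B. \<phi> u = a \<and> \<phi> v = b \<and> {u, v} \<in> edges B"
    if ab: "{a, b} \<in> edges B'" for a b
  proof -
    consider "a \<in> X" | "b \<in> X" | "a \<notin> X" "b \<notin> X" by blast
    then show ?thesis
    proof cases
      case 1
      then obtain v where "v \<in> verts B" "\<phi> v = a" "{b, v} \<in> edges B" "b \<in> verts B" "\<phi> b = b"
        using endX[OF ab] by blast
      moreover from this have "{v, b} \<in> edges B" by (simp add: insert_commute)
      ultimately show ?thesis by blast
    next
      case 2
      moreover have "{b, a} \<in> edges B'" using ab by (simp add: insert_commute)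
      ultimately show ?thesis using endX by blast
    next
      case 3
      then have "{a, b} \<in> edges B" "a \<in> verts B'" "b \<in> verts B'"
        using ab T'sub(2) unfolding edges_B by auto
      then show ?thesis using Bsub(2) \<phi>_B' by blast
    qed
  qed
  show thesis
  proof (rule that)
    show "\<phi> u = \<phi> v \<or> {\<phi> u, \<phi> v} \<in> edges T'" if "{u, v} \<in> edges T" for u v
      using edge_T[OF that] by blast
  qed (fact image_B fibre edge_B)+
qed

section \<open>Transport along isomorphisms and the final estimate\<close>

lemma joined_iso:
  assumes "graph_iso f G H" "\<forall>e\<in>edges G. e \<subseteq> verts G" "joined G n u v"
  shows "joined H n (f u) (f v)"
proof (rule joined_map[OF assms(3)])
  fix a b assume "{a, b} \<in> edges G"
  then show "f a = f b \<or> {f a, f b} \<in> edges H"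
    using assms(1,2) unfolding graph_iso_def by blast
qed

lemma joined_iso_inv:
  assumes "graph_iso f G H" "\<forall>e\<in>edges H. e \<subseteq> verts H"
    and "u \<in> verts G" "v \<in> verts G" "joined H n (f u) (f v)"
  shows "joined G n u v"
proof -
  let ?g = "inv_into (verts G) f"
  have bij: "bij_betw f (verts G) (verts H)" using assms(1) by (simp add: graph_iso_def)
  have "joined G n (?g (f u)) (?g (f v))"
  proof (rule joined_map[OF assms(5)])
    fix a b assume ab: "{a, b} \<in> edges H"
    then have "a \<in> verts H" "b \<in> verts H" using assms(2) by auto
    then have "f (?g a) = a" "f (?g b) = b" "?g a \<in> verts G" "?g b \<in> verts G"
      using bij by (simp_all add: bij_betw_inv_into_right bij_betw_def inv_into_into)
    then show "?g a = ?g b \<or> {?g a, ?g b} \<in> edges G"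
      using ab assms(1) unfolding graph_iso_def by metis
  qed
  then show ?thesis using bij assms(3,4) by (simp add: bij_betw_inv_into_left)
qed

theorem theorem3p3:
  fixes t d :: nat and T B :: "'a graph" and x y :: 'a
  assumes "5 \<le> t" and "0 < d"
    and "canonical_territory t T B"
    and "x \<in> verts B" and "y \<in> verts B"
    and "graph_dist T x y \<le> enat d"
  shows "graph_dist B x y \<le> enat (t ^ (d + 3 * t))"
proof -
  obtain m T' B' f where terr: "territory T B"
    and exp: "expansion t (terr_T t m) (terr_B t m) T' B'"
    and iso: "graph_iso f T T'" "graph_iso f B B'"
    using assms(3) unfolding canonical_territory_def by blast
  have terr': "territory T' B'" using exp unfolding expansion_def by blast
  obtain \<phi> where \<phi>:
    "\<And>u v. {u, v} \<in> edges T' \<Longrightarrow> \<phi> u = \<phi> v \<or> {\<phi> u, \<phi> v} \<in> edges (terr_T t m)"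
    "\<And>u. u \<in> verts B' \<Longrightarrow> \<phi> u \<in> verts (terr_B t m)"
    "\<And>u v. u \<in> verts B' \<Longrightarrow> v \<in> verts B' \<Longrightarrow> \<phi> u = \<phi> v \<Longrightarrow> joined B' (3 * t) u v"
    "\<And>a b. {a, b} \<in> edges (terr_B t m) \<Longrightarrow>
      \<exists>u\<in>verts B'. \<exists>v\<in>verts B'. \<phi> u = a \<and> \<phi> v = b \<and> {u, v} \<in> edges B'"
    using expansion_collapse[OF assms(1) exp] by blast
  define D where "D = (t - 3) ^ d"
  have f: "f x \<in> verts B'" "f y \<in> verts B'"
    using iso(2) assms(4,5) unfolding graph_iso_def by (auto dest: bij_betwE)
  have "joined T' d (f x) (f y)"
    by (rule joined_iso[OF iso(1) territory_edges_subset(1)[OF terr]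
      joined_if_graph_dist_le[OF assms(6)]])
  then have "joined (terr_T t m) d (\<phi> (f x)) (\<phi> (f y))"
    using \<phi>(1) by (rule joined_map)
  then have "joined (terr_B t m) D (\<phi> (f x)) (\<phi> (f y))"
    unfolding D_def
    by (rule joined_terr_B_if_joined_terr_T[OF assms(1) \<phi>(2)[OF f(1)] \<phi>(2)[OF f(2)]])
  \<comment> \<open>\<open>D\<close> lifted edges, and one detour of at most \<open>3 * t\<close>
    steps for each of the \<open>Suc D\<close> fibres.\<close>
  then have "joined B' (D + Suc D * (3 * t)) (f x) (f y)"
    using f \<phi>(3,4) by (rule joined_lift)
  then have "joined B (D + Suc D * (3 * t)) x y"
    by (rule joined_iso_inv[OF iso(2) territory_edges_subset(2)[OF terr'] assms(4,5)])
  \<comment> \<open>With \<open>D \<le> t ^ d\<close> and \<open>Suc D \<le> 2 * t ^ d\<close> the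
    sum is at most \<open>t ^ d\<close> times \<open>1 + 6 * t\<close>. The second factor is at most
    \<open>t ^ 3\<close> because \<open>t \<ge> 5\<close>, and \<open>3 \<le> 3 * t\<close>.\<close>
  moreover have "D + Suc D * (3 * t) \<le> t ^ (d + 3 * t)"
  proof -
    have D: "D \<le> t ^ d" "1 \<le> t ^ d"
      unfolding D_def using assms(1) by (auto intro: power_mono)
    have "D + Suc D * (3 * t) \<le> t ^ d + (2 * t ^ d) * (3 * t)"
      using D by (intro add_mono mult_right_mono) auto
    also have "\<dots> = t ^ d * (1 + 6 * t)" by (simp add: algebra_simps)
    also have "\<dots> \<le> t ^ d * t ^ 3"
    proof (rule mult_left_mono)
      have "1 + 6 * t \<le> 5 * 5 * t" using assms(1) by simp
      also have "\<dots> \<le> t * t * t" using assms(1) by (intro mult_mono) auto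
      finally show "1 + 6 * t \<le> t ^ 3" by (simp add: power3_eq_cube)
    qed simp
    also have "\<dots> \<le> t ^ (d + 3 * t)"
      unfolding power_add[symmetric] using assms(1) by (intro power_increasing) auto
    finally show ?thesis .
  qed
  ultimately have "joined B (t ^ (d + 3 * t)) x y" by (rule joined_mono)
  then show ?thesis
    using assms(4) territory_edges_subset(2)[OF terr] by (rule graph_dist_le_if_joined)
qed

end
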